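(* Every positive integer $N$ with at least one odd divisor $d>1$ is expressible as a sum of consecutive positive integers. More precisely, for each odd divisor $d>1$ of $N$, writing $N=d\cdot d'$, the number $N$ may be written as the sum of consecutive positive integers $$\left(d'-\frac{d-1}{2}\right)+\left(d'-\frac{d-1}{2}+1\right)+\cdots+\left(d'+\frac{d-1}{2}\right)$$ if $d<2d'$, and as the sum of consecutive positive integers $$\left(\frac{d+1}{2}-d'\right)+\left(\frac{d+1}{2}-d'+1\right)+\cdots+\left(\frac{d-1}{2}+d'\right)$$ if $d>2d'$.
   Context: A sum of consecutive positive integers is a sum $a+(a+1)+\cdots+(a+r-1)$ with $r\ge 2$ terms, where $a$ is a positive integer. *)

theory Defs
  imports Main
begin

(* N = a + (a+1) + ... + (a+r-1) with a a positive integer, at least two terms, and last term b.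
   Integers rather than naturals, so that the subtractions in a and b are not truncated. *)
definition consecutive_sum_from_to :: "int \<Rightarrow> int \<Rightarrow> int \<Rightarrow> bool" where
  "consecutive_sum_from_to N a b \<longleftrightarrow>
     a > 0 \<and> (\<exists>r::nat. r \<ge> 2 \<and> b = a + int r - 1 \<and> N = (\<Sum>i<r. a + int i))"

definition sum_of_consecutive_positive_integers :: "int \<Rightarrow> bool" where
  "sum_of_consecutive_positive_integers N \<longleftrightarrow> (\<exists>a b. consecutive_sum_from_to N a b)"

end

theory Submission
  imports Defs
begin

text \<open>
  An arithmetic progression with difference 1 running from \<open>a\<close> to \<open>b\<close> sums to its number of terms,
  \<open>b - a + 1\<close>, times its mean, \<open>(a + b) / 2\<close>; so \<open>N\<close> is such a sum as soon as
  \<open>2 * N = (b - a + 1) * (a + b)\<close> with \<open>0 < a < b\<close>. This is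
  \<open>consecutive_sum_from_to_if_twice_eq\<close>.

  Let \<open>N = d * d'\<close> with \<open>d\<close> odd. The factorization \<open>2 * N = d * (2 * d')\<close> has one odd and one even
  factor, and either may serve as the number of terms. Taking \<open>d\<close> terms gives the \<open>d\<close> integers
  centred at \<open>d'\<close>, which are all positive exactly when \<open>d < 2 * d'\<close>. Taking \<open>2 * d'\<close> terms gives the
  integers centred at \<open>d / 2\<close>, which are all positive exactly when \<open>d > 2 * d'\<close>. Since \<open>d\<close> is odd,
  equality is impossible, so one of the two choices always works.
\<close>

lemma twice_sum_consecutive:
  fixes a :: int
  shows "2 * (\<Sum>i<r. a + int i) = int r * (2 * a + int r - 1)"
  by (induction r) (simp_all add: algebra_simps)

text \<open>The hypothesis is doubled because the mean \<open>(a + b) / 2\<close> need not be an integer; the strict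
  inequality between the endpoints is what makes the sum have at least two terms.\<close>

lemma consecutive_sum_from_to_if_twice_eq:
  assumes "0 < a" and "a < b" and eq: "2 * N = (b - a + 1) * (a + b)"
  shows "consecutive_sum_from_to N a b"
proof -
  define r where "r = nat (b - a + 1)"
  have r: "int r = b - a + 1"
    using \<open>a < b\<close> by (simp add: r_def)
  have "2 * N = 2 * (\<Sum>i<r. a + int i)"
    unfolding eq twice_sum_consecutive r by (simp add: algebra_simps)
  then have "N = (\<Sum>i<r. a + int i)"
    by simp
  moreover have "r \<ge> 2" "b = a + int r - 1"
    using r \<open>a < b\<close> by linarith+
  ultimately show ?thesis
    using \<open>0 < a\<close> unfolding consecutive_sum_from_to_def by blast
qed

lemma consecutive_sum_centred_at_cofactor:
  fixes d d' :: int
  assumes "odd d" and "d > 1" and "d < 2 * d'"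
  shows "consecutive_sum_from_to (d * d') (d' - (d - 1) div 2) (d' + (d - 1) div 2)"
proof -
  obtain k where d: "d = 2 * k + 1"
    using \<open>odd d\<close> by (rule oddE)
  show ?thesis
    by (rule consecutive_sum_from_to_if_twice_eq) (use assms in \<open>auto simp: d algebra_simps\<close>)
qed

text \<open>For \<open>d > 2 * d'\<close> the \<open>d\<close> integers centred at \<open>d'\<close> begin with
  \<open>- ((d - 1) div 2 - d'), \<dots>, (d - 1) div 2 - d'\<close>, which add up to 0. What is left are the
  \<open>2 * d'\<close> integers centred at \<open>d / 2\<close>.\<close>

lemma consecutive_sum_centred_at_half_divisor:
  fixes d d' :: int
  assumes "odd d" and "d' > 0" and "d > 2 * d'"
  shows "consecutive_sum_from_to (d * d') ((d + 1) div 2 - d') ((d - 1) div 2 + d')"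
proof -
  obtain k where d: "d = 2 * k + 1"
    using \<open>odd d\<close> by (rule oddE)
  have half: "(d + 1) div 2 = k + 1" "(d - 1) div 2 = k"
    by (simp_all add: d)
  show ?thesis
    unfolding half
    by (rule consecutive_sum_from_to_if_twice_eq) (use assms in \<open>auto simp: d algebra_simps\<close>)
qed

theorem theorem2:
  fixes N :: int
  assumes "N > 0"
  shows "((\<exists>d. odd d \<and> d > 1 \<and> d dvd N) \<longrightarrow> sum_of_consecutive_positive_integers N) \<and>
    (\<forall>d d'. odd d \<and> d > 1 \<and> N = d * d' \<longrightarrow>
       (d < 2 * d' \<longrightarrow>
          consecutive_sum_from_to N (d' - (d - 1) div 2) (d' + (d - 1) div 2)) \<and>
       (d > 2 * d' \<longrightarrow>
          consecutive_sum_from_to N ((d + 1) div 2 - d') ((d - 1) div 2 + d')))"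
proof -
  have small: "consecutive_sum_from_to N (d' - (d - 1) div 2) (d' + (d - 1) div 2)"
    if "odd d" "d > 1" "N = d * d'" "d < 2 * d'" for d d'
    using consecutive_sum_centred_at_cofactor that by simp
  have large: "consecutive_sum_from_to N ((d + 1) div 2 - d') ((d - 1) div 2 + d')"
    if "odd d" "d > 1" "N = d * d'" "d > 2 * d'" for d d'
  proof -
    have "d' > 0"
      using \<open>N > 0\<close> that by (simp add: zero_less_mult_iff)
    then show ?thesis
      using consecutive_sum_centred_at_half_divisor that by simp
  qed
  have "sum_of_consecutive_positive_integers N" if "odd d" "d > 1" "d dvd N" for d
  proof -
    obtain d' where d': "N = d * d'"
      using \<open>d dvd N\<close> by (rule dvdE)
    have "d \<noteq> 2 * d'"
      using \<open>odd d\<close> by auto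
    then consider "d < 2 * d'" | "d > 2 * d'"
      by linarith
    then show ?thesis
      unfolding sum_of_consecutive_positive_integers_def
      using small large that d' by cases blast+
  qed
  then show ?thesis
    using small large by blast
qed

end
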